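(* Let $\Phi$ be the root system of a split connected reductive affine algebraic group $G$ over a field $K$ relative to a split maximal torus $T$, let $W_\circ$ be its finite Weyl group, and fix a simple system $\Delta\subset\Phi$ with corresponding positive system $\Pi$. For $w\in W_\circ$ put $\mathcal{L}(w)=\{b\in\Pi : w(b)\in-\Pi\}$. Then for all $w\in W_\circ$ and all $a\in\Phi$, $$\sum_{b\in\mathcal{L}(w)}\langle a,b^\vee\rangle=\mathrm{Ht}(a)-\mathrm{Ht}(w(a)).$$
   Context: $b^\vee$ denotes the coroot of $b\in\Phi$ and $\langle\cdot,\cdot\rangle$ the natural pairing between characters and cocharacters. $\mathrm{Ht}:\Phi\to\mathbf{Z}$ is the height function relative to $\Delta=\{\alpha_1,\dots,\alpha_n\}$: $\mathrm{Ht}(\sum_i m_i\alpha_i)=\sum_i m_i$. *)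

theory Defs
  imports Complex_Main "HOL-Algebra.Bij" "HOL-Algebra.Generated_Groups"
begin

text \<open>
  The combinatorial data attached to a split connected reductive group \<open>G\<close> over a field and a split
  maximal torus \<open>T\<close> are formalized as a reduced root datum: \<open>'x\<close> is the character group of \<open>T\<close>,
  \<open>'y\<close> its cocharacter group, \<open>pairing\<close> the natural pairing between them, \<open>\<Phi>\<close> the set of roots
  and \<open>coroot\<close> the bijection from roots to coroots. The Weyl group is represented by its faithful
  action on the character group.
\<close>

definition int_scale :: "int \<Rightarrow> 'a::ab_group_add \<Rightarrow> 'a" where
  "int_scale k x =
     (if 0 \<le> k then (((+) x) ^^ nat k) 0 else - ((((+) x) ^^ nat (- k)) 0))"

lemma int_scale_0 [simp]: "int_scale 0 x = 0"
  by (simp add: int_scale_def)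

lemma int_scale_succ: "int_scale (k + 1) x = x + int_scale k x"
proof -
  consider "0 \<le> k" | "k = - 1" | "k < - 1" by linarith
  then show ?thesis
  proof cases
    case 1
    then have "nat (k + 1) = Suc (nat k)" by simp
    with 1 show ?thesis by (simp add: int_scale_def)
  next
    case 2
    then show ?thesis by (simp add: int_scale_def)
  next
    case 3
    then have "nat (- k) = Suc (nat (- (k + 1)))" by simp
    with 3 show ?thesis unfolding int_scale_def by simp
  qed
qed

lemma int_scale_pred: "int_scale (k - 1) x = int_scale k x - x"
  using int_scale_succ [of "k - 1" x] by simp

lemma int_scale_add_right: "int_scale k (x + y) = int_scale k x + int_scale k y"
  by (induction k rule: int_induct [where k = 0])
    (simp_all add: int_scale_succ int_scale_pred algebra_simps)

lemma int_scale_add_left: "int_scale (k + l) x = int_scale k x + int_scale l x"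
proof (induction k rule: int_induct [where k = 0])
  case (step1 i)
  have "i + 1 + l = (i + l) + 1" by simp
  then have "int_scale (i + 1 + l) x = x + int_scale (i + l) x"
    by (simp only: int_scale_succ)
  with step1 show ?case by (simp add: int_scale_succ add.assoc)
next
  case (step2 i)
  have "i - 1 + l = (i + l) - 1" by simp
  then have "int_scale (i - 1 + l) x = int_scale (i + l) x - x"
    by (simp only: int_scale_pred)
  with step2 show ?case by (simp add: int_scale_pred)
qed simp

lemma int_scale_minus_left: "int_scale (- k) x = - int_scale k x"
  using int_scale_add_left [of k "- k" x] by (simp add: eq_neg_iff_add_eq_0 add.commute)

lemma int_scale_int_scale: "int_scale k (int_scale l x) = int_scale (k * l) x"
proof (induction k rule: int_induct [where k = 0])
  case (step1 i)
  have "(i + 1) * l = l + i * l" by (simp add: algebra_simps)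
  then have "int_scale ((i + 1) * l) x = int_scale l x + int_scale (i * l) x"
    by (simp only: int_scale_add_left)
  with step1 show ?case by (simp add: int_scale_succ)
next
  case (step2 i)
  have "(i - 1) * l = i * l + - l" by (simp add: algebra_simps)
  then have "int_scale ((i - 1) * l) x = int_scale (i * l) x - int_scale l x"
    by (simp only: int_scale_add_left int_scale_minus_left) simp
  with step2 show ?case by (simp add: int_scale_pred)
qed simp

interpretation int_module: module int_scale
proof
  show "int_scale 1 x = x" for x :: 'a
    using int_scale_succ [of 0 x] by simp
qed (simp_all add: int_scale_add_right int_scale_add_left int_scale_int_scale)

definition reflection ::
  "('x::ab_group_add \<Rightarrow> 'y::ab_group_add \<Rightarrow> int) \<Rightarrow> ('x \<Rightarrow> 'y) \<Rightarrow> 'x \<Rightarrow> 'x \<Rightarrow> 'x" where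
  "reflection pairing coroot a x = x - int_scale (pairing x (coroot a)) a"

definition coreflection ::
  "('x::ab_group_add \<Rightarrow> 'y::ab_group_add \<Rightarrow> int) \<Rightarrow> ('x \<Rightarrow> 'y) \<Rightarrow> 'x \<Rightarrow> 'y \<Rightarrow> 'y" where
  "coreflection pairing coroot a y = y - int_scale (pairing a y) (coroot a)"

locale perfect_pairing =
  fixes pairing :: "'x::ab_group_add \<Rightarrow> 'y::ab_group_add \<Rightarrow> int"
  assumes additive_left: "additive (\<lambda>x. pairing x y)"
    and additive_right: "additive (\<lambda>y. pairing x y)"
    and perfect_left: "bij_betw (\<lambda>x y. pairing x y) UNIV {f. additive f}"
    and perfect_right: "bij_betw (\<lambda>y x. pairing x y) UNIV {f. additive f}"

locale root_datum = perfect_pairing pairing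
  for pairing :: "'x::ab_group_add \<Rightarrow> 'y::ab_group_add \<Rightarrow> int" +
  fixes \<Phi> :: "'x set" and coroot :: "'x \<Rightarrow> 'y"
  assumes free_characters:
      "\<exists>B::'x set. finite B \<and> int_module.independent B \<and> int_module.span B = UNIV"
    and free_cocharacters:
      "\<exists>B::'y set. finite B \<and> int_module.independent B \<and> int_module.span B = UNIV"
    and finite_roots: "finite \<Phi>"
    and inj_coroot: "inj_on coroot \<Phi>"
    and pairing_coroot: "a \<in> \<Phi> \<Longrightarrow> pairing a (coroot a) = 2"
    and reflection_roots: "a \<in> \<Phi> \<Longrightarrow> reflection pairing coroot a ` \<Phi> = \<Phi>"
    and coreflection_coroots:
      "a \<in> \<Phi> \<Longrightarrow> coreflection pairing coroot a ` (coroot ` \<Phi>) = coroot ` \<Phi>"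

text \<open>
  Reducedness: the only rational multiples of a root \<open>a\<close> that are roots are \<open>a\<close> and \<open>- a\<close>. The
  relation \<open>b = (m / n) a\<close> is written without denominators.
\<close>

locale reduced_root_datum = root_datum pairing \<Phi> coroot
  for pairing :: "'x::ab_group_add \<Rightarrow> 'y::ab_group_add \<Rightarrow> int"
    and \<Phi> :: "'x set" and coroot :: "'x \<Rightarrow> 'y" +
  assumes reduced:
    "\<lbrakk>a \<in> \<Phi>; b \<in> \<Phi>; n \<noteq> 0; int_scale n b = int_scale m a\<rbrakk> \<Longrightarrow> b = a \<or> b = - a"

definition weyl_group ::
  "('x::ab_group_add \<Rightarrow> 'y::ab_group_add \<Rightarrow> int) \<Rightarrow> 'x set \<Rightarrow> ('x \<Rightarrow> 'y) \<Rightarrow> ('x \<Rightarrow> 'x) set" where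
  "weyl_group pairing \<Phi> coroot = generate (BijGroup UNIV) (reflection pairing coroot ` \<Phi>)"

definition simple_system :: "'x::ab_group_add set \<Rightarrow> 'x set \<Rightarrow> bool" where
  "simple_system \<Phi> \<Delta> \<longleftrightarrow>
     \<Delta> \<subseteq> \<Phi> \<and> int_module.independent \<Delta> \<and>
     (\<forall>a\<in>\<Phi>. \<exists>m. a = (\<Sum>d\<in>\<Delta>. int_scale (m d) d) \<and>
        ((\<forall>d\<in>\<Delta>. 0 \<le> m d) \<or> (\<forall>d\<in>\<Delta>. m d \<le> 0)))"

definition positive_system :: "'x::ab_group_add set \<Rightarrow> 'x set \<Rightarrow> 'x set" where
  "positive_system \<Phi> \<Delta> =
     {a \<in> \<Phi>. \<exists>m. a = (\<Sum>d\<in>\<Delta>. int_scale (m d) d) \<and> (\<forall>d\<in>\<Delta>. 0 \<le> m d)}"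

definition height :: "'x::ab_group_add set \<Rightarrow> 'x \<Rightarrow> int" where
  "height \<Delta> a = (\<Sum>d\<in>\<Delta>. int_module.representation \<Delta> a d)"

definition inversion_set :: "'x::ab_group_add set \<Rightarrow> 'x set \<Rightarrow> ('x \<Rightarrow> 'x) \<Rightarrow> 'x set" where
  "inversion_set \<Phi> \<Delta> w =
     {b \<in> positive_system \<Phi> \<Delta>. w b \<in> uminus ` positive_system \<Phi> \<Delta>}"

lemma height_sum:
  assumes "finite \<Delta>" "int_module.independent \<Delta>"
  shows "height \<Delta> (\<Sum>d\<in>\<Delta>. int_scale (m d) d) = (\<Sum>d\<in>\<Delta>. m d)"
proof -
  have "int_module.representation \<Delta> (\<Sum>d\<in>\<Delta>. int_scale (m d) d) e = m e" if "e \<in> \<Delta>" for e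
  proof -
    have "int_module.representation \<Delta> (\<Sum>d\<in>\<Delta>. int_scale (m d) d) e
        = (\<Sum>d\<in>\<Delta>. int_module.representation \<Delta> (int_scale (m d) d) e)"
      using assms
      by (subst int_module.representation_sum)
        (auto intro: int_module.span_scale int_module.span_base)
    also have "\<dots> = (\<Sum>d\<in>\<Delta>. m d * (if d = e then 1 else 0))"
      using assms
      by (intro sum.cong)
        (auto simp: int_module.representation_scale int_module.span_base
          int_module.representation_basis)
    also have "\<dots> = m e"
      using assms that by (simp add: if_distrib cong: if_cong)
    finally show ?thesis .
  qed
  then show ?thesis by (simp add: height_def)
qed

context root_datum
begin

lemma reflection_reflection:
  assumes "a \<in> \<Phi>"
  shows "reflection pairing coroot a (reflection pairing coroot a x) = x"
proof -
  interpret l: additive "\<lambda>x. pairing x (coroot a)" by (rule additive_left)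
  have scale: "pairing (int_scale k a) (coroot a) = k * 2" for k
    by (induction k rule: int_induct [where k = 0])
      (simp_all add: l.zero l.add l.diff int_scale_succ int_scale_pred pairing_coroot assms)
  show ?thesis
    by (simp add: reflection_def l.diff scale flip: int_module.scale_left_distrib)
qed

lemma reflection_in_BijGroup:
  assumes "a \<in> \<Phi>"
  shows "reflection pairing coroot a \<in> carrier (BijGroup UNIV)"
  using reflection_reflection [OF assms]
  by (auto simp: BijGroup_def Bij_def intro!: o_bij [where g = "reflection pairing coroot a"])

lemma subgroup_weyl_group: "subgroup (weyl_group pairing \<Phi> coroot) (BijGroup UNIV)"
  unfolding weyl_group_def
  by (rule group.generate_is_subgroup [OF group_BijGroup]) (auto intro: reflection_in_BijGroup)

end

end

theory Submission
  imports Defs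
begin

text \<open>
  Let \<open>H x\<close> be the sum of \<open>\<langle>x, b\<^sup>\<or>\<rangle>\<close> over all positive roots \<open>b\<close>. Up to signs, which occur exactly on
  the inversion set, a Weyl group element \<open>w\<close> permutes the positive roots, so invariance of the
  pairing gives \<open>H (w a) = H a - 2 (\<Sum>b\<in>\<L>(w). \<langle>a, b\<^sup>\<or>\<rangle>)\<close>. For a simple reflection \<open>w\<close> in \<open>d\<close> the
  inversion set is \<open>{d}\<close>, and \<open>a = d\<close> yields \<open>H d = 2\<close>; hence \<open>H\<close> is twice the height.
\<close>

section \<open>Reflections and the invariance of the root-coroot pairing\<close>

context root_datum
begin

abbreviation \<sigma> where "\<sigma> \<equiv> reflection pairing coroot"

lemma pairing_add: "pairing (x + y) z = pairing x z + pairing y z"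
  using additive.add [OF additive_left] .

lemma pairing_diff: "pairing (x - y) z = pairing x z - pairing y z"
  using additive.diff [OF additive_left] .

lemma pairing_minus: "pairing (- x) z = - pairing x z"
  using additive.minus [OF additive_left] .

lemma pairing_zero: "pairing 0 z = 0"
  using additive.zero [OF additive_left] .

lemma pairing_scale: "pairing (int_scale k x) z = k * pairing x z"
  by (induction k rule: int_induct [where k = 0])
    (simp_all add: pairing_zero pairing_add pairing_diff int_scale_succ int_scale_pred algebra_simps)

lemma refl_root: "a \<in> \<Phi> \<Longrightarrow> b \<in> \<Phi> \<Longrightarrow> \<sigma> a b \<in> \<Phi>"
  using reflection_roots by blast

lemma refl_self: "a \<in> \<Phi> \<Longrightarrow> \<sigma> a a = - a"
proof -
  assume "a \<in> \<Phi>"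
  then have "\<sigma> a a = a - int_scale (1 + 1) a"
    by (simp add: reflection_def pairing_coroot)
  also have "\<dots> = - a"
    by (simp only: int_scale_add_left) simp
  finally show ?thesis .
qed

lemma uminus_root: "a \<in> \<Phi> \<Longrightarrow> - a \<in> \<Phi>"
  using refl_root refl_self by metis

lemma additive_refl: "additive (\<sigma> a)"
  by unfold_locales
    (simp add: reflection_def pairing_add int_scale_add_left)

text \<open>
  The composite of the reflections defined by \<open>f\<close> and \<open>g\<close> is \<open>x \<mapsto> x + (g x - f x) c\<close>. It is a transvection preserving
  the finite set of roots, hence trivial there.
\<close>

lemma reflection_functional_unique:
  assumes f: "additive f" "f c = 2" "\<And>x. x \<in> \<Phi> \<Longrightarrow> x - int_scale (f x) c \<in> \<Phi>"
    and g: "additive g" "g c = 2" "\<And>x. x \<in> \<Phi> \<Longrightarrow> x - int_scale (g x) c \<in> \<Phi>"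
    and x: "x \<in> \<Phi>"
  shows "f x = (g x :: int)"
proof (rule ccontr)
  assume neq: "f x \<noteq> g x"
  interpret f: additive f by fact
  interpret g: additive g by fact
  have scale: "h (int_scale k c) = k * 2" if "additive h" "h c = 2" for h and k :: int
  proof -
    interpret h: additive h by fact
    show ?thesis
      by (induction k rule: int_induct [where k = 0])
        (simp_all add: h.zero h.add h.diff int_scale_succ int_scale_pred that(2))
  qed
  define e where "e = g x - f x"
  \<comment> \<open>Since \<open>f\<close> and \<open>g\<close> agree on \<open>c\<close>, the
    difference \<open>g - f\<close> has the constant value \<open>e\<close> along the line through
    \<open>x\<close> in direction \<open>c\<close>. Each application of the composite therefore
    moves by exactly \<open>e\<close> times \<open>c\<close>.\<close>
  have orbit: "x + int_scale (int n * e) c \<in> \<Phi>" for n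
  proof (induction n)
    case 0
    show ?case using x by simp
  next
    case (Suc n)
    define y where "y = x + int_scale (int n * e) c"
    define z where "z = y - int_scale (g y) c"
    have "z - int_scale (f z) c \<in> \<Phi>"
      unfolding z_def by (rule f(3), rule g(3)) (use Suc in \<open>simp add: y_def\<close>)
    moreover have "f z = f y - g y * 2"
      by (simp add: z_def f.diff scale [OF f(1,2)])
    moreover have "g y - f y = e"
      by (simp add: y_def f.add g.add scale [OF f(1,2)] scale [OF g(1,2)] e_def)
    ultimately have "y - int_scale (g y) c - int_scale (f y - g y * 2) c \<in> \<Phi>"
      by (simp add: z_def)
    moreover have "y - int_scale (g y) c - int_scale (f y - g y * 2) c
        = y - int_scale (g y + (f y - g y * 2)) c"
      by (simp only: int_scale_add_left) (simp add: algebra_simps)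
    moreover have "g y + (f y - g y * 2) = - e"
      using \<open>g y - f y = e\<close> by simp
    moreover have "y + int_scale e c = x + int_scale (int (Suc n) * e) c"
      by (simp add: y_def algebra_simps int_scale_add_left)
    ultimately show ?case by (simp add: int_scale_minus_left)
  qed
  \<comment> \<open>Applying \<open>f\<close> turns multiples of \<open>c\<close> into integers:
    \<open>f c = 2\<close> and \<open>e\<close> is nonzero, so the orbit never repeats.\<close>
  have "inj (\<lambda>n. x + int_scale (int n * e) c)"
  proof (rule injI)
    fix m n
    assume "x + int_scale (int m * e) c = x + int_scale (int n * e) c"
    then have "f (int_scale (int m * e) c) = f (int_scale (int n * e) c)" by simp
    then show "m = n" using neq by (simp add: scale [OF f(1,2)] e_def)
  qed
  then have "infinite (range (\<lambda>n. x + int_scale (int n * e) c))"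
    using finite_imageD infinite_UNIV_nat by blast
  moreover have "range (\<lambda>n. x + int_scale (int n * e) c) \<subseteq> \<Phi>"
    using orbit by blast
  ultimately show False
    using finite_roots finite_subset by blast
qed

text \<open>As functions of \<open>x\<close>, both sides define reflections in the root
  \<open>\<sigma> a b\<close> that preserve the roots: the left one by the axioms, the right one
  because it is the conjugate of \<open>\<sigma> b\<close> by \<open>\<sigma> a\<close>. Uniqueness
  of such a functional on the roots identifies them.\<close>

lemma pairing_coroot_refl:
  assumes a: "a \<in> \<Phi>" and b: "b \<in> \<Phi>" and x: "x \<in> \<Phi>"
  shows "pairing x (coroot (\<sigma> a b)) = pairing (\<sigma> a x) (coroot b)"
proof (rule reflection_functional_unique [OF _ _ _ _ _ _ x])
  interpret r: additive "\<sigma> a" by (rule additive_refl)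
  have scale: "\<sigma> a (int_scale k b) = int_scale k (\<sigma> a b)" for k
    by (induction k rule: int_induct [where k = 0])
      (simp_all add: r.zero r.add r.diff int_scale_succ int_scale_pred)
  show "additive (\<lambda>x. pairing x (coroot (\<sigma> a b)))" by (rule additive_left)
  show "pairing (\<sigma> a b) (coroot (\<sigma> a b)) = 2"
    by (simp add: pairing_coroot refl_root a b)
  show "y - int_scale (pairing y (coroot (\<sigma> a b))) (\<sigma> a b) \<in> \<Phi>" if "y \<in> \<Phi>" for y
    using refl_root [OF refl_root [OF a b] that] by (simp add: reflection_def [of _ _ "\<sigma> a b"])
  show "additive (\<lambda>x. pairing (\<sigma> a x) (coroot b))"
    by unfold_locales (simp add: r.add pairing_add)
  show "pairing (\<sigma> a (\<sigma> a b)) (coroot b) = 2"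
    by (simp add: reflection_reflection a b pairing_coroot)
  show "y - int_scale (pairing (\<sigma> a y) (coroot b)) (\<sigma> a b) \<in> \<Phi>" if "y \<in> \<Phi>" for y
  proof -
    have "\<sigma> a (\<sigma> b (\<sigma> a y)) \<in> \<Phi>"
      by (intro refl_root a b that)
    moreover have "\<sigma> a (\<sigma> b (\<sigma> a y))
        = y - int_scale (pairing (\<sigma> a y) (coroot b)) (\<sigma> a b)"
      by (simp add: reflection_def [of _ _ b] r.diff scale reflection_reflection a)
    ultimately show ?thesis by simp
  qed
qed

text \<open>This is invariance under \<open>\<sigma> b\<close> itself, which sends \<open>b\<close>
  to \<open>- b\<close> and negates the functional given by the coroot of \<open>b\<close>.\<close>

lemma pairing_coroot_uminus:
  assumes "b \<in> \<Phi>" "x \<in> \<Phi>"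
  shows "pairing x (coroot (- b)) = - pairing x (coroot b)"
  using pairing_coroot_refl [OF assms(1,1,2)] assms(1)
  by (simp add: refl_self) (simp add: reflection_def pairing_diff pairing_scale pairing_coroot)

section \<open>Weyl group elements as automorphisms of the root system\<close>

text \<open>The action on coroots is expressed through \<open>coroot (w b)\<close>, so no dual map
  on cocharacters appears. Invariance is asked for on roots only, where uniqueness of the reflecting
  functional provides it.\<close>

definition root_automorphism :: "('x \<Rightarrow> 'x) \<Rightarrow> bool" where
  "root_automorphism w \<longleftrightarrow> additive w \<and> inj w \<and> w ` \<Phi> \<subseteq> \<Phi> \<and>
     (\<forall>x\<in>\<Phi>. \<forall>b\<in>\<Phi>. pairing (w x) (coroot (w b)) = pairing x (coroot b))"

lemma root_automorphism_refl:
  assumes "a \<in> \<Phi>"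
  shows "root_automorphism (\<sigma> a)"
proof -
  have "inj (\<sigma> a)"
    using reflection_reflection [OF assms] by (metis injI)
  then show ?thesis
    unfolding root_automorphism_def
    using additive_refl refl_root assms
    by (auto simp: pairing_coroot_refl reflection_reflection)
qed

lemma root_automorphism_comp:
  assumes "root_automorphism v" "root_automorphism w"
  shows "root_automorphism (v \<circ> w)"
  using assms unfolding root_automorphism_def additive_def
  by (auto simp: image_subset_iff intro: inj_compose)

lemma root_automorphism_weyl_group:
  assumes "w \<in> weyl_group pairing \<Phi> coroot"
  shows "root_automorphism w"
proof -
  let ?G = "BijGroup (UNIV :: 'x set)"
  interpret G: group ?G by (rule group_BijGroup)
  \<comment> \<open>Multiplication in \<open>BijGroup\<close> is restricted to the carrier, so it is
    rewritten to composition only for its members.\<close>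
  have mult: "g \<otimes>\<^bsub>?G\<^esub> h = g \<circ> h" if "g \<in> carrier ?G" "h \<in> carrier ?G" for g h
    using that by (auto simp: BijGroup_def compose_def)
  have one: "\<one>\<^bsub>?G\<^esub> = id"
    by (auto simp: BijGroup_def)
  have carrier: "generate ?G (\<sigma> ` \<Phi>) \<subseteq> carrier ?G"
    by (rule G.generate_incl) (auto intro: reflection_in_BijGroup)
  from assms show ?thesis
    unfolding weyl_group_def
  proof (induction rule: generate.induct)
    case one
    show ?case
      by (auto simp: \<open>\<one>\<^bsub>?G\<^esub> = id\<close> root_automorphism_def additive_def)
  next
    case (incl h)
    then show ?case by (auto intro: root_automorphism_refl)
  next
    case (inv h)
    then obtain a where a: "a \<in> \<Phi>" "h = \<sigma> a" by blast
    \<comment> \<open>A reflection is an involution, so the inverse of a generator is again that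
      generator.\<close>
    then have "h \<otimes>\<^bsub>?G\<^esub> h = \<one>\<^bsub>?G\<^esub>"
      by (auto simp: mult one reflection_in_BijGroup reflection_reflection)
    then have "inv\<^bsub>?G\<^esub> h = h"
      using a reflection_in_BijGroup by (intro G.inv_equality) auto
    then show ?case using a root_automorphism_refl by simp
  next
    case (eng g h)
    then have "g \<otimes>\<^bsub>?G\<^esub> h = g \<circ> h"
      using carrier by (intro mult) auto
    then show ?case using eng.IH by (simp only: root_automorphism_comp)
  qed
qed

end

section \<open>Positive roots relative to a simple system\<close>

locale based_root_datum = reduced_root_datum pairing \<Phi> coroot
  for pairing :: "'x::ab_group_add \<Rightarrow> 'y::ab_group_add \<Rightarrow> int"
    and \<Phi> :: "'x set" and coroot :: "'x \<Rightarrow> 'y" +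
  fixes \<Delta> :: "'x set"
  assumes simple: "simple_system \<Phi> \<Delta>"
begin

abbreviation Pos where "Pos \<equiv> positive_system \<Phi> \<Delta>"

lemma simple_roots: "\<Delta> \<subseteq> \<Phi>" and independent: "int_module.independent \<Delta>"
  using simple by (auto simp: simple_system_def)

lemma finite_simple: "finite \<Delta>"
  using simple_roots finite_roots finite_subset by blast

lemma positive_roots: "Pos \<subseteq> \<Phi>"
  by (auto simp: positive_system_def)

lemma finite_positive: "finite Pos"
  using positive_roots finite_roots finite_subset by blast

lemma coefficients_unique:
  assumes "(\<Sum>d\<in>\<Delta>. int_scale (m d) d) = (\<Sum>d\<in>\<Delta>. int_scale (n d) d)" "d \<in> \<Delta>"
  shows "m d = n d"
proof -
  have "(\<Sum>d\<in>\<Delta>. int_scale (m d - n d) d) = 0"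
    using assms(1) by (simp add: int_module.scale_left_diff_distrib sum_subtractf)
  then have "m d - n d = 0"
    using int_module.independentD
      [OF independent finite_simple subset_refl, of "\<lambda>d. m d - n d"] assms(2) by simp
  then show ?thesis by simp
qed

lemma zero_not_root: "0 \<notin> \<Phi>"
  using pairing_coroot pairing_zero by force

text \<open>By uniqueness, the coefficients of \<open>b\<close> would be both nonnegative and
  nonpositive, forcing \<open>b = 0\<close>, which is not a root.\<close>

lemma uminus_positive_not_positive:
  assumes "b \<in> Pos"
  shows "- b \<notin> Pos"
proof
  assume "- b \<in> Pos"
  then obtain n where n: "- b = (\<Sum>d\<in>\<Delta>. int_scale (n d) d)" "\<forall>d\<in>\<Delta>. 0 \<le> n d"
    by (auto simp: positive_system_def)
  obtain m where m: "b = (\<Sum>d\<in>\<Delta>. int_scale (m d) d)" "\<forall>d\<in>\<Delta>. 0 \<le> m d"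
    using assms by (auto simp: positive_system_def)
  have "b = (\<Sum>d\<in>\<Delta>. int_scale (- n d) d)"
    by (simp add: int_scale_minus_left sum_negf flip: n(1))
  then have "m d = - n d" if "d \<in> \<Delta>" for d
    using coefficients_unique [of m "\<lambda>d. - n d"] m(1) that by simp
  then have "m d = 0" if "d \<in> \<Delta>" for d
    using m(2) n(2) that by force
  then have "b = 0" using m(1) by simp
  then show False using assms positive_roots zero_not_root by blast
qed

lemma root_cases:
  assumes "a \<in> \<Phi>"
  shows "a \<in> Pos \<or> - a \<in> Pos"
proof -
  obtain m where m: "a = (\<Sum>d\<in>\<Delta>. int_scale (m d) d)"
    and sgn: "(\<forall>d\<in>\<Delta>. 0 \<le> m d) \<or> (\<forall>d\<in>\<Delta>. m d \<le> 0)"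
    using simple assms unfolding simple_system_def by blast
  from sgn show ?thesis
  proof
    assume "\<forall>d\<in>\<Delta>. 0 \<le> m d"
    then show ?thesis using m assms by (auto simp: positive_system_def)
  next
    assume "\<forall>d\<in>\<Delta>. m d \<le> 0"
    moreover have "- a = (\<Sum>d\<in>\<Delta>. int_scale (- m d) d)"
      by (simp add: m int_scale_minus_left sum_negf)
    ultimately have "- a \<in> Pos"
      using uminus_root [OF assms] unfolding positive_system_def
      by (intro CollectI conjI exI [of _ "\<lambda>d. - m d"]) auto
    then show ?thesis ..
  qed
qed

section \<open>Inversion sets and the sum of the positive coroots\<close>

lemma inversion_set_iff: "b \<in> inversion_set \<Phi> \<Delta> w \<longleftrightarrow> b \<in> Pos \<and> - w b \<in> Pos"
  by (auto simp: inversion_set_def image_iff) (metis minus_minus)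

lemma simple_positive:
  assumes "d \<in> \<Delta>"
  shows "d \<in> Pos"
proof -
  have "(\<Sum>e\<in>\<Delta>. int_scale (if e = d then 1 else 0) e) = (\<Sum>e\<in>\<Delta>. if e = d then e else 0)"
    by (intro sum.cong) auto
  also have "\<dots> = d"
    using assms finite_simple by simp
  finally show ?thesis
    using assms simple_roots unfolding positive_system_def
    by (intro CollectI conjI exI [of _ "\<lambda>e. if e = d then 1 else 0"]) auto
qed

text \<open>This is the pairing with the sum of the positive coroots, usually called twice
  rho-check.\<close>

definition positive_coroot_pairing :: "'x \<Rightarrow> int" where
  "positive_coroot_pairing x = (\<Sum>b\<in>Pos. pairing x (coroot b))"

lemma positive_coroot_pairing_automorphism:
  assumes w: "root_automorphism w" and a: "a \<in> \<Phi>"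
  shows "positive_coroot_pairing (w a)
    = positive_coroot_pairing a - 2 * (\<Sum>b\<in>inversion_set \<Phi> \<Delta> w. pairing a (coroot b))"
proof -
  let ?L = "inversion_set \<Phi> \<Delta> w"
  interpret w: additive w
    using w by (simp add: root_automorphism_def)
  have inj: "inj w" and root: "w b \<in> \<Phi>" if "b \<in> \<Phi>" for b
    using w that by (auto simp: root_automorphism_def)
  have inv: "pairing (w x) (coroot (w b)) = pairing x (coroot b)" if "x \<in> \<Phi>" "b \<in> \<Phi>" for x b
    using w that by (simp add: root_automorphism_def)
  \<comment> \<open>The sign correction makes \<open>w\<close> an injective self-map of the finite
    set \<open>Pos\<close>, hence a permutation by which the sum can be reindexed.\<close>
  define p where "p b = (if b \<in> ?L then - w b else w b)" for b
  have p_positive: "p b \<in> Pos" if "b \<in> Pos" for b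
    using that root_cases [OF root] positive_roots by (auto simp: p_def inversion_set_iff)
  have p_inj: "inj_on p Pos"
  proof (rule inj_onI)
    fix b c
    assume bc: "b \<in> Pos" "c \<in> Pos" "p b = p c"
    then have "w b = w c \<or> w b = w (- c)"
      by (auto simp: p_def w.minus split: if_splits) (metis minus_minus)+
    then have "b = c \<or> b = - c"
      using inj [OF a] by (auto dest: injD)
    then show "b = c"
      using bc uminus_positive_not_positive by auto
  qed
  have "p ` Pos = Pos"
    using endo_inj_surj [OF finite_positive _ p_inj] p_positive by blast
  then have "positive_coroot_pairing (w a) = (\<Sum>b\<in>Pos. pairing (w a) (coroot (p b)))"
    unfolding positive_coroot_pairing_def
    using sum.reindex [OF p_inj, of "\<lambda>b. pairing (w a) (coroot b)"] by simp
  \<comment> \<open>On the inversion set the coroot of \<open>- w b\<close> reverses the sign of the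
    summand, and a sign change amounts to subtracting the summand twice.\<close>
  also have "\<dots> = (\<Sum>b\<in>Pos. pairing a (coroot b) - 2 * (if b \<in> ?L then pairing a (coroot b) else 0))"
    using positive_roots a
    by (intro sum.cong) (auto simp: p_def pairing_coroot_uminus root inv subset_iff)
  also have "\<dots> = positive_coroot_pairing a - 2 * (\<Sum>b\<in>Pos. if b \<in> ?L then pairing a (coroot b) else 0)"
    by (simp only: positive_coroot_pairing_def sum_subtractf sum_distrib_left)
  also have "(\<Sum>b\<in>Pos. if b \<in> ?L then pairing a (coroot b) else 0) = (\<Sum>b\<in>Pos \<inter> ?L. pairing a (coroot b))"
    by (rule sum.inter_restrict [symmetric]) (rule finite_positive)
  also have "Pos \<inter> ?L = ?L"
    by (auto simp: inversion_set_iff)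
  finally show ?thesis .
qed

text \<open>The reflection \<open>\<sigma> d\<close> changes only the coefficient of
  \<open>d\<close>, so a positive root made negative by it has no other nonzero coefficient.
  Reducedness and positivity then leave only \<open>d\<close>.\<close>

lemma inversion_set_simple_refl:
  assumes d: "d \<in> \<Delta>"
  shows "inversion_set \<Phi> \<Delta> (\<sigma> d) = {d}"
proof
  have dr: "d \<in> \<Phi>" using d simple_roots by blast
  show "{d} \<subseteq> inversion_set \<Phi> \<Delta> (\<sigma> d)"
    using d dr by (auto simp: inversion_set_iff refl_self simple_positive)
  show "inversion_set \<Phi> \<Delta> (\<sigma> d) \<subseteq> {d}"
  proof
    fix b
    assume "b \<in> inversion_set \<Phi> \<Delta> (\<sigma> d)"
    then have b: "b \<in> Pos" and neg: "- \<sigma> d b \<in> Pos"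
      by (simp_all add: inversion_set_iff)
    obtain m where m: "b = (\<Sum>e\<in>\<Delta>. int_scale (m e) e)" "\<forall>e\<in>\<Delta>. 0 \<le> m e"
      using b by (auto simp: positive_system_def)
    obtain n where n: "- \<sigma> d b = (\<Sum>e\<in>\<Delta>. int_scale (n e) e)" "\<forall>e\<in>\<Delta>. 0 \<le> n e"
      using neg by (auto simp: positive_system_def)
    define k where "k = pairing b (coroot d)"
    have delta: "(\<Sum>e\<in>\<Delta>. int_scale (if e = d then j else 0) e) = int_scale j d" for j
    proof -
      have "(\<Sum>e\<in>\<Delta>. int_scale (if e = d then j else 0) e) = (\<Sum>e\<in>\<Delta>. if e = d then int_scale j e else 0)"
        by (intro sum.cong) auto
      then show ?thesis using d finite_simple by simp
    qed
    have "b = int_scale k d + - (- \<sigma> d b)"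
      by (simp add: reflection_def k_def)
    also have "\<dots> = (\<Sum>e\<in>\<Delta>. int_scale ((if e = d then k else 0) + - n e) e)"
      by (simp only: n(1) int_scale_add_left sum.distrib delta int_scale_minus_left sum_negf)
    finally have "m e = (if e = d then k else 0) + - n e" if "e \<in> \<Delta>" for e
      using coefficients_unique [of m "\<lambda>e. (if e = d then k else 0) + - n e"] m(1) that by simp
    \<comment> \<open>For \<open>e\<close> other than \<open>d\<close> the equation reads
      \<open>m e = - n e\<close> with \<open>m e\<close> and \<open>n e\<close> both
      nonnegative.\<close>
    then have "m e = (if e = d then m d else 0)" if "e \<in> \<Delta>" for e
      using m(2) n(2) that by force
    then have "b = (\<Sum>e\<in>\<Delta>. int_scale (if e = d then m d else 0) e)"
      unfolding m(1) by (intro sum.cong) auto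
    then have "int_scale 1 b = int_scale (m d) d"
      by (simp add: delta)
    then have "b = d \<or> b = - d"
      using reduced [of d b 1 "m d"] dr b positive_roots by auto
    then show "b \<in> {d}"
      using b simple_positive [OF d] uminus_positive_not_positive by auto
  qed
qed

text \<open>Writing H for the coroot sum, the transformation formula for \<open>\<sigma> d\<close>
  at \<open>d\<close> reads - H(d) = H(d) - 2 * 2.\<close>

lemma positive_coroot_pairing_simple:
  assumes "d \<in> \<Delta>"
  shows "positive_coroot_pairing d = 2"
proof -
  have d: "d \<in> \<Phi>" using assms simple_roots by blast
  have "positive_coroot_pairing (- d) = - positive_coroot_pairing d"
    by (simp add: positive_coroot_pairing_def pairing_minus sum_negf)
  then show ?thesis
    using positive_coroot_pairing_automorphism [OF root_automorphism_refl [OF d] d]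
    by (simp add: inversion_set_simple_refl assms refl_self d pairing_coroot)
qed

text \<open>Expanding \<open>a\<close> in simple roots and using additivity, each simple root
  contributes 2 times its coefficient.\<close>

lemma positive_coroot_pairing_eq_height:
  assumes "a \<in> \<Phi>"
  shows "positive_coroot_pairing a = 2 * height \<Delta> a"
proof -
  obtain m where m: "a = (\<Sum>d\<in>\<Delta>. int_scale (m d) d)"
    using simple assms unfolding simple_system_def by blast
  interpret H: additive positive_coroot_pairing
    by unfold_locales (simp add: positive_coroot_pairing_def pairing_add sum.distrib)
  have scale: "positive_coroot_pairing (int_scale k x) = k * positive_coroot_pairing x" for k x
    by (simp add: positive_coroot_pairing_def pairing_scale sum_distrib_left)
  have "positive_coroot_pairing a = (\<Sum>d\<in>\<Delta>. m d * 2)"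
    unfolding m H.sum by (intro sum.cong) (simp_all add: scale positive_coroot_pairing_simple)
  also have "\<dots> = 2 * height \<Delta> a"
    unfolding m height_sum [OF finite_simple independent] by (simp add: sum_distrib_left mult.commute [of _ 2])
  finally show ?thesis .
qed

end

theorem proposition3p2p1:
  fixes pairing :: "'x::ab_group_add \<Rightarrow> 'y::ab_group_add \<Rightarrow> int"
    and \<Phi> \<Delta> :: "'x set" and coroot :: "'x \<Rightarrow> 'y"
    and w :: "'x \<Rightarrow> 'x" and a :: 'x
  assumes "reduced_root_datum pairing \<Phi> coroot"
    and "simple_system \<Phi> \<Delta>"
    and "w \<in> weyl_group pairing \<Phi> coroot"
    and "a \<in> \<Phi>"
  shows "(\<Sum>b\<in>inversion_set \<Phi> \<Delta> w. pairing a (coroot b)) = height \<Delta> a - height \<Delta> (w a)"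
proof -
  interpret based_root_datum pairing \<Phi> coroot \<Delta>
    using assms(1,2) by (simp add: based_root_datum_def based_root_datum_axioms_def)
  have w: "root_automorphism w"
    by (rule root_automorphism_weyl_group) fact
  \<comment> \<open>The coroot sum is identified with twice the height on roots only, so
    \<open>w a\<close> has to be a root before the factor 2 is cancelled.\<close>
  then have "w a \<in> \<Phi>"
    using assms(4) by (auto simp: root_automorphism_def)
  then show ?thesis
    using positive_coroot_pairing_automorphism [OF w assms(4)] assms(4)
    by (simp add: positive_coroot_pairing_eq_height)
qed

end
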